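(* Let $\mathbf G=(V,E)$ be a finite simple undirected graph. Let $z$ and $\mathbf z_E=(z_{uv})_{uv\in E}$ be independent commuting indeterminates, and define $$\Psi_{\mathbf G}(z,\mathbf z_E)=\prod_{v\in V}\bigl(1+z\,Z_{E(v)}\bigr)\prod_{uv\in E}(1+z_{uv}),$$ where $Z_{E(v)}$ is the product of the $z_{e}$ over all edges $e\in E$ incident to $v$. Then the independence polynomial $\pi_\alpha(z)$ of $\mathbf G$ is the coefficient $$\pi_\alpha(z)=\Bigl[\textstyle\prod_{uv\in E} z_{uv}\Bigr]\,\Psi_{\mathbf G}(z,\mathbf z_E).$$
   Context: An independent set of $\mathbf G$ is a subset of $V$ no two of whose vertices are adjacent; its order is its cardinality (the empty set has order $0$). $A_k$ is the number of independent sets of order $k\ge0$, and the independence polynomial is $\pi_\alpha(z)=\sum_{k\ge 0}A_kz^k$. The bracket $[\prod_{uv\in E} z_{uv}]F(z,\mathbf z_E)$ denotes the coefficient of the monomial $\prod_{uv\in E}z_{uv}$ when $F$ is regarded as a polynomial in the edge indeterminates $z_{uv}$ with coefficients that are polynomials in $z$. An empty product equals $1$. $\Psi_{\mathbf G}$ is called the partition function of $\mathbf G$. *)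

theory Defs
  imports "HOL-Library.Poly_Mapping" "HOL-Computational_Algebra.Polynomial"
begin

definition finite_simple_graph :: "'v set \<Rightarrow> 'v set set \<Rightarrow> bool" where
  "finite_simple_graph V E \<longleftrightarrow> finite V \<and> (\<forall>e\<in>E. e \<subseteq> V \<and> card e = 2)"

definition independent_set :: "'v set \<Rightarrow> 'v set set \<Rightarrow> 'v set \<Rightarrow> bool" where
  "independent_set V E S \<longleftrightarrow> S \<subseteq> V \<and> (\<forall>u\<in>S. \<forall>v\<in>S. {u, v} \<notin> E)"

definition num_independent_sets :: "'v set \<Rightarrow> 'v set set \<Rightarrow> nat \<Rightarrow> nat" where
  "num_independent_sets V E k = card {S. independent_set V E S \<and> card S = k}"

text \<open>For finite \<open>V\<close> there are no independent sets of order greater than \<open>card V\<close>, so the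
  sum over all orders may be truncated there.\<close>

definition independence_poly :: "'v set \<Rightarrow> 'v set set \<Rightarrow> 'a::comm_semiring_1 poly" where
  "independence_poly V E = (\<Sum>k\<le>card V. monom (of_nat (num_independent_sets V E k)) k)"

text \<open>Polynomials in indeterminates indexed by \<open>'e\<close>, with coefficients that are polynomials in
  the one further indeterminate \<open>z\<close>. A monomial in the indexed indeterminates is given by its
  finitely supported exponent function, of type \<open>'e \<Rightarrow>\<^sub>0 nat\<close>; the monomial 1 is \<open>0\<close>, and the product
  of monomials is the sum of their exponents.\<close>

type_synonym ('e, 'a) edge_poly = "('e \<Rightarrow>\<^sub>0 nat) \<Rightarrow>\<^sub>0 'a poly"

definition z_var :: "('e, 'a::comm_semiring_1) edge_poly" where
  "z_var = Poly_Mapping.single 0 (monom 1 1)"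

definition edge_var :: "'e \<Rightarrow> ('e, 'a::comm_semiring_1) edge_poly" where
  "edge_var e = Poly_Mapping.single (Poly_Mapping.single e 1) 1"

definition edge_monomial :: "'e set \<Rightarrow> 'e \<Rightarrow>\<^sub>0 nat" where
  "edge_monomial E = (\<Sum>e\<in>E. Poly_Mapping.single e 1)"

definition edge_coeff :: "('e \<Rightarrow>\<^sub>0 nat) \<Rightarrow> ('e, 'a::comm_semiring_1) edge_poly \<Rightarrow> 'a poly" where
  "edge_coeff m F = Poly_Mapping.lookup F m"

definition partition_fun ::
    "'v set \<Rightarrow> 'v set set \<Rightarrow> ('v set, 'a::comm_semiring_1) edge_poly" where
  "partition_fun V E =
     (\<Prod>v\<in>V. 1 + z_var * (\<Prod>e\<in>{e\<in>E. v \<in> e}. edge_var e)) * (\<Prod>e\<in>E. 1 + edge_var e)"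

end

theory Submission imports Defs begin

text \<open>
  Expanding both products of the partition function gives one term for each pair of a vertex
  set \<open>S \<subseteq> V\<close> and an edge set \<open>F \<subseteq> E\<close>: the power of \<open>z\<close> is \<open>card S\<close>, and
  the exponent of the indeterminate of an edge \<open>e\<close> is the number of endpoints of \<open>e\<close> in
  \<open>S\<close>, plus one if \<open>e \<in> F\<close>. All these exponents equal \<open>1\<close> precisely when no edge has
  both endpoints in \<open>S\<close> and \<open>F\<close> consists of the edges that \<open>S\<close> misses. So the factor
  \<open>\<Prod>e\<in>E. 1 + edge_var e\<close> fills up the missing edges in exactly one way if \<open>S\<close> is
  independent, and in no way otherwise (\<open>exponent_eq_edge_monomial_iff\<close>). What remains of the
  coefficient is the generating function of the independent sets by their order
  (\<open>independence_poly_eq_sum\<close>).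
\<close>

lemma prod_poly_mapping_single:
  "(\<Prod>i\<in>I. Poly_Mapping.single (m i) (c i)) =
     (Poly_Mapping.single (\<Sum>i\<in>I. m i) (\<Prod>i\<in>I. c i) :: 'm::comm_monoid_add \<Rightarrow>\<^sub>0 'c::comm_semiring_1)"
  by (induction I rule: infinite_finite_induct) (simp_all add: mult_single)

lemma lookup_edge_monomial:
  assumes "finite E"
  shows "Poly_Mapping.lookup (edge_monomial E) e = of_bool (e \<in> E)"
  using assms by (auto simp: edge_monomial_def lookup_sum lookup_single when_def)

lemma prod_edge_var: "(\<Prod>e\<in>F. edge_var e) = Poly_Mapping.single (edge_monomial F) 1"
  by (simp add: edge_var_def edge_monomial_def prod_poly_mapping_single)

text \<open>The indeterminate of an edge occurs once in the monomial of each of its endpoints, so a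
  product of such monomials over \<open>S\<close> counts the endpoints in \<open>S\<close>.\<close>

lemma lookup_sum_incident_edges:
  assumes "finite E" "finite S"
  shows "Poly_Mapping.lookup (\<Sum>v\<in>S. edge_monomial {e\<in>E. v \<in> e}) e =
           (if e \<in> E then card (S \<inter> e) else 0)"
  using assms by (simp add: lookup_sum lookup_edge_monomial Int_def flip: sum.inter_filter)

text \<open>As every edge has exactly two endpoints, it joins two vertices of \<open>S\<close> if and only if
  \<open>card (S \<inter> e) = 2\<close>. This turns independence into a condition on exponents.\<close>

lemma independent_set_iff_card_Int:
  assumes "finite_simple_graph V E" "S \<subseteq> V"
  shows "independent_set V E S \<longleftrightarrow> (\<forall>e\<in>E. card (S \<inter> e) \<le> 1)"
proof
  assume indep: "independent_set V E S"
  show "\<forall>e\<in>E. card (S \<inter> e) \<le> 1"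
  proof
    fix e assume "e \<in> E"
    then obtain u v where e: "e = {u, v}" "u \<noteq> v"
      using assms by (auto simp: finite_simple_graph_def card_2_iff)
    then have "u \<notin> S \<or> v \<notin> S"
      using indep \<open>e \<in> E\<close> by (auto simp: independent_set_def)
    then have "S \<inter> e \<subseteq> {u} \<or> S \<inter> e \<subseteq> {v}" using e by auto
    then show "card (S \<inter> e) \<le> 1"
      by (metis card_mono finite.emptyI finite.insertI is_singletonI is_singleton_altdef)
  qed
next
  assume le: "\<forall>e\<in>E. card (S \<inter> e) \<le> 1"
  have "{u, v} \<notin> E" if "u \<in> S" "v \<in> S" for u v
  proof
    assume uv: "{u, v} \<in> E"
    then have "card {u, v} = 2"
      using assms by (auto simp: finite_simple_graph_def)
    moreover have "S \<inter> {u, v} = {u, v}" using that by auto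
    ultimately show False using le uv by fastforce
  qed
  then show "independent_set V E S"
    using assms by (auto simp: independent_set_def)
qed

text \<open>The exponent of \<open>e\<close> on the left is \<open>card (S \<inter> e)\<close>, plus one if \<open>e \<in> F\<close>. For it to
  be \<open>1\<close>, either \<open>e\<close> has one endpoint in \<open>S\<close> and is left out of \<open>F\<close>, or it has none and
  belongs to \<open>F\<close>.\<close>

lemma exponent_eq_edge_monomial_iff:
  assumes G: "finite_simple_graph V E" and "finite E" "S \<subseteq> V" "F \<subseteq> E"
  shows "(\<Sum>v\<in>S. edge_monomial {e\<in>E. v \<in> e}) + edge_monomial F = edge_monomial E \<longleftrightarrow>
           independent_set V E S \<and> F = {e\<in>E. S \<inter> e = {}}"
proof -
  have S: "finite S" and F: "finite F"
    using assms by (auto simp: finite_simple_graph_def intro: finite_subset)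
  have "(\<Sum>v\<in>S. edge_monomial {e\<in>E. v \<in> e}) + edge_monomial F = edge_monomial E \<longleftrightarrow>
          (\<forall>e\<in>E. card (S \<inter> e) + of_bool (e \<in> F) = 1)"
    using S F assms(2,4)
    by (auto simp: poly_mapping_eq_iff fun_eq_iff lookup_add lookup_sum_incident_edges
        lookup_edge_monomial)
  also have "\<dots> \<longleftrightarrow> (\<forall>e\<in>E. card (S \<inter> e) \<le> 1 \<and> (e \<in> F \<longleftrightarrow> card (S \<inter> e) = 0))"
    by (rule ball_cong) auto
  also have "\<dots> \<longleftrightarrow> independent_set V E S \<and> F = {e\<in>E. S \<inter> e = {}}"
    using S assms(4) by (auto simp: independent_set_iff_card_Int[OF G assms(3)])
  finally show ?thesis .
qed

lemma independence_poly_eq_sum: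
  assumes "finite V"
  shows "(independence_poly V E :: 'a::comm_semiring_1 poly) =
           (\<Sum>S | independent_set V E S. monom 1 (card S))"
proof -
  let ?I = "{S. independent_set V E S}"
  have fin: "finite ?I"
    by (rule finite_subset[of _ "Pow V"]) (use assms in \<open>auto simp: independent_set_def\<close>)
  have "card ` ?I \<subseteq> {..card V}"
    using assms by (auto simp: independent_set_def card_mono)
  then have "(\<Sum>S\<in>?I. monom (1::'a) (card S)) =
               (\<Sum>k\<le>card V. \<Sum>S | S \<in> ?I \<and> card S = k. monom 1 (card S))"
    using fin by (subst sum.group) auto
  also have "\<dots> = (\<Sum>k\<le>card V. monom (of_nat (num_independent_sets V E k)) k)"
    by (intro sum.cong)
      (simp_all add: num_independent_sets_def of_nat_monom mult_monom)
  finally show ?thesis by (simp add: independence_poly_def)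
qed

lemma partition_fun_expand:
  assumes "finite V" "finite E"
  shows "(partition_fun V E :: ('v set, 'a::comm_semiring_1) edge_poly) =
           (\<Sum>S\<in>Pow V. \<Sum>F\<in>Pow E.
              Poly_Mapping.single
                ((\<Sum>v\<in>S. edge_monomial {e\<in>E. v \<in> e}) + edge_monomial F) (monom 1 (card S)))"
  using assms
  \<comment> \<open>With the summand \<open>1\<close> in second place, the product over the complement in \<open>prod_add\<close>
    disappears.\<close>
  by (simp add: partition_fun_def add.commute[of 1] prod_add prod_edge_var z_var_def mult_single
      prod_poly_mapping_single sum_product monom_power)

theorem lemma2:
  fixes V :: "'v set" and E :: "'v set set"
  assumes "finite_simple_graph V E"
  shows "(independence_poly V E :: 'a::comm_semiring_1 poly) =
           edge_coeff (edge_monomial E) (partition_fun V E)"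
proof -
  have V: "finite V" using assms by (simp add: finite_simple_graph_def)
  have E: "finite E"
    by (rule finite_subset[of _ "Pow V"]) (use assms in \<open>auto simp: finite_simple_graph_def\<close>)
  have "edge_coeff (edge_monomial E) (partition_fun V E :: ('v set, 'a) edge_poly) =
          (\<Sum>S\<in>Pow V. \<Sum>F\<in>Pow E. monom 1 (card S) when
             (\<Sum>v\<in>S. edge_monomial {e\<in>E. v \<in> e}) + edge_monomial F = edge_monomial E)"
    by (simp add: edge_coeff_def partition_fun_expand[OF V E] lookup_sum lookup_single)
  also have "\<dots> = (\<Sum>S\<in>Pow V. \<Sum>F\<in>Pow E.
      if F = {e\<in>E. S \<inter> e = {}} then (monom 1 (card S) when independent_set V E S) else 0)"
    by (intro sum.cong) (auto simp: exponent_eq_edge_monomial_iff[OF assms E] when_def)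
  also have "\<dots> = (\<Sum>S\<in>Pow V. monom 1 (card S) when independent_set V E S)"
    using E by (intro sum.cong) (auto simp: sum.delta)
  also have "\<dots> = (\<Sum>S | independent_set V E S. monom 1 (card S))"
    unfolding when_def
    by (rule sum.mono_neutral_cong_right) (use V in \<open>auto simp: independent_set_def\<close>)
  finally show ?thesis by (simp add: independence_poly_eq_sum[OF V])
qed

end
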